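(* Let $L>0$, let $f\in\mathcal{F}^2_L(\mathbb{R}^n)$ with a minimizer $x^\star$, let $x_0\in\mathbb{R}^n$, let $s>0$, and put $t_0=\frac{3}{2}\sqrt{s}$. Let $X=X(t)$, $t\ge t_0$, be the solution of the ODE $$\ddot X(t)+\frac{3}{t}\dot X(t)+\sqrt{s}\,\nabla^2 f(X(t))\dot X(t)+\left(1+\frac{3\sqrt{s}}{2t}\right)\nabla f(X(t))=0,\qquad X(t_0)=x_0,\quad \dot X(t_0)=-\sqrt{s}\,\nabla f(x_0).$$ Then, for all $t>t_0$, $$\inf_{t_0\le u\le t}\|\nabla f(X(u))\|^2\le \frac{(12+9sL)\|x_0-x^\star\|^2}{2\sqrt{s}\,(t^3-t_0^3)}.$$
   Context: $\|\cdot\|$ is the Euclidean norm. $\mathcal{F}^2_L(\mathbb{R}^n)$ is the class of convex functions $f:\mathbb{R}^n\to\mathbb{R}$ whose gradient is $L$-Lipschitz ($\|\nabla f(x)-\nabla f(y)\|\le L\|x-y\|$ for all $x,y$) and whose Hessian exists and is Lipschitz continuous. The ODE is the high-resolution ODE of Nesterov's accelerated gradient method for convex functions (NAG-C). *)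

theory Defs
  imports "HOL-Analysis.Analysis"
begin

definition gradient :: "('a::real_inner \<Rightarrow> real) \<Rightarrow> 'a \<Rightarrow> 'a" where
  "gradient f x = (THE g. GDERIV f x :> g)"

definition hessian :: "(real ^ 'n \<Rightarrow> real) \<Rightarrow> real ^ 'n \<Rightarrow> real ^ 'n ^ 'n" where
  "hessian f x = jacobian (gradient f) (at x)"

text \<open>
  The Hessian is Lipschitz with respect to the Frobenius norm on matrices, the norm of
  the type; since all norms on a finite-dimensional space are equivalent and the Lipschitz
  constant is not recorded in the class, the choice of matrix norm is immaterial.
\<close>

definition F2 :: "real \<Rightarrow> (real ^ 'n \<Rightarrow> real) set" where
  "F2 L = {f. convex_on UNIV f \<and>
     (\<forall>x. f differentiable (at x)) \<and>
     (\<forall>x y. norm (gradient f x - gradient f y) \<le> L * norm (x - y)) \<and>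
     (\<forall>x. gradient f differentiable (at x)) \<and>
     (\<exists>M. M-lipschitz_on UNIV (hessian f))}"

text \<open>
  \<open>V\<close> and \<open>A\<close> are the first and second derivatives of \<open>X\<close> on \<open>[t\<^sub>0, \<infinity>)\<close>,
  one-sided at \<open>t\<^sub>0\<close>.
\<close>

definition nag_c_solution ::
  "(real ^ 'n \<Rightarrow> real) \<Rightarrow> real \<Rightarrow> real ^ 'n \<Rightarrow> real \<Rightarrow> (real \<Rightarrow> real ^ 'n) \<Rightarrow> bool" where
  "nag_c_solution f s x\<^sub>0 t\<^sub>0 X \<longleftrightarrow>
     (\<exists>V A.
        (\<forall>t\<ge>t\<^sub>0. (X has_vector_derivative V t) (at t within {t\<^sub>0..})) \<and>
        (\<forall>t\<ge>t\<^sub>0. (V has_vector_derivative A t) (at t within {t\<^sub>0..})) \<and>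
        (\<forall>t\<ge>t\<^sub>0. A t + (3 / t) *\<^sub>R V t + sqrt s *\<^sub>R (hessian f (X t) *v V t)
                 + (1 + 3 * sqrt s / (2 * t)) *\<^sub>R gradient f (X t) = 0) \<and>
        X t\<^sub>0 = x\<^sub>0 \<and> V t\<^sub>0 = - (sqrt s *\<^sub>R gradient f x\<^sub>0))"

end

theory Submission
  imports Defs
begin

text \<open>
  With \<open>g = \<nabla>f(X)\<close> and \<open>w = t X' + 2 (X - x\<^sup>*) + t \<surd>s g\<close>, the ODE says exactly
  \<open>w' = - (t + \<surd>s/2) g\<close>. Hence, by convexity, the Lyapunov function
  \<open>t (t + \<surd>s/2) (f(X) - f(x\<^sup>*)) + \<bar>w\<bar>\<^sup>2/2\<close> has derivative at most \<open>- \<surd>s t\<^sup>2 \<bar>g\<bar>\<^sup>2\<close>.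
  Integrating from \<open>t\<^sub>0\<close>, where \<open>w = 2 (x\<^sub>0 - x\<^sup>*)\<close> and the descent lemma bounds
  \<open>f(x\<^sub>0) - f(x\<^sup>*)\<close> by \<open>L/2 \<bar>x\<^sub>0 - x\<^sup>*\<bar>\<^sup>2\<close>, gives the estimate.
\<close>

text \<open>\<open>gradient\<close> is a definite description, so it is usable only once existence
  and uniqueness are known. Riesz representation gives existence: the derivative \<open>f'\<close>
  is pairing with \<open>adjoint f' 1\<close>. Uniqueness of the derivative pins down that
  vector.\<close>

lemma gradient_has_derivative:
  fixes f :: "'a::euclidean_space \<Rightarrow> real"
  assumes "f differentiable (at x)"
  shows "(f has_derivative (\<lambda>h. gradient f x \<bullet> h)) (at x)"
proof -
  obtain f' where f': "(f has_derivative f') (at x)"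
    using assms unfolding differentiable_def by blast
  interpret linear f' using f' by (rule has_derivative_linear)
  define g where "g = adjoint f' 1"
  have f'_eq: "f' h = h \<bullet> g" for h
    using adjoint_works[OF linear_axioms, of h 1] by (simp add: g_def)
  have g: "GDERIV f x :> g"
    using f' unfolding gderiv_def f'_eq[abs_def] by simp
  have "gradient f x = g"
    unfolding gradient_def
  proof (rule the_equality)
    show "GDERIV f x :> g" by (rule g)
  next
    fix k assume "GDERIV f x :> k"
    then have "(\<lambda>h. h \<bullet> k) = (\<lambda>h. h \<bullet> g)"
      using g unfolding gderiv_def by (rule has_derivative_unique)
    then have "\<forall>h. h \<bullet> k = h \<bullet> g" by (simp add: fun_eq_iff)
    then show "k = g" by (simp only: vector_eq_ldot)
  qed
  with g show ?thesis by (simp add: gderiv_def inner_commute)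
qed

lemma hessian_has_derivative:
  assumes "gradient f differentiable (at x)"
  shows "(gradient f has_derivative (\<lambda>h. hessian f x *v h)) (at x)"
  using assms unfolding hessian_def by (simp add: jacobian_works)

lemma line_has_real_derivative:
  fixes f :: "'a::euclidean_space \<Rightarrow> real"
  assumes "f differentiable (at (a + u *\<^sub>R d))"
  shows "((\<lambda>u. f (a + u *\<^sub>R d)) has_real_derivative gradient f (a + u *\<^sub>R d) \<bullet> d) (at u)"
proof -
  have "((\<lambda>u. a + u *\<^sub>R d) has_vector_derivative d) (at u)"
    by (auto intro!: derivative_eq_intros)
  from vector_derivative_diff_chain_within[OF this,
      OF has_derivative_at_withinI, OF gradient_has_derivative, OF assms]
  show ?thesis
    by (simp add: has_real_derivative_iff_has_vector_derivative comp_def)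
qed

text \<open>On the segment from \<open>x\<close> to \<open>y\<close>, convexity keeps every
  difference quotient based at \<open>x\<close> below the slope of the whole chord. Letting the step
  shrink to 0 from the right turns the quotient into a directional derivative.\<close>

lemma convex_gradient_ineq:
  fixes f :: "'a::euclidean_space \<Rightarrow> real"
  assumes "convex_on UNIV f" and "f differentiable (at x)"
  shows "f x - f y \<le> gradient f x \<bullet> (x - y)"
proof -
  define h where "h = (\<lambda>u. f (x + u *\<^sub>R (y - x)))"
  have h_convex: "convex_on {0..1} h"
  proof (rule convex_onI)
    fix r a b :: real assume r: "0 < r" "r < 1"
    have "x + ((1 - r) * a + r * b) *\<^sub>R (y - x)
        = (1 - r) *\<^sub>R (x + a *\<^sub>R (y - x)) + r *\<^sub>R (x + b *\<^sub>R (y - x))"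
      by (simp add: algebra_simps)
    then show "h ((1 - r) *\<^sub>R a + r *\<^sub>R b) \<le> (1 - r) * h a + r * h b"
      using convex_onD[OF assms(1), of r "x + a *\<^sub>R (y - x)" "x + b *\<^sub>R (y - x)"] r
      by (simp add: h_def)
  qed simp
  have sec: "h u - h 0 \<le> (h 1 - h 0) * u" if "u \<in> {0..1}" for u
    using convex_onD[OF h_convex, of u 0 1] that by (simp add: algebra_simps)
  have "(h has_real_derivative gradient f x \<bullet> (y - x)) (at 0 within {0..1})"
    using line_has_real_derivative[of f x 0 "y - x"] assms(2)
    by (auto simp: h_def intro: DERIV_subset)
  then have "((\<lambda>u. (h u - h 0) / (u - 0)) \<longlongrightarrow> gradient f x \<bullet> (y - x)) (at 0 within {0..1})"
    by (simp add: has_field_derivative_iff)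
  moreover have "\<forall>\<^sub>F u in at 0 within {0..1}. (h u - h 0) / (u - 0) \<le> h 1 - h 0"
    unfolding eventually_at_filter using sec by (auto simp: divide_le_eq)
  moreover have "at 0 within {0..1::real} \<noteq> bot"
    by (simp add: at_within_Icc_at_right)
  ultimately have "gradient f x \<bullet> (y - x) \<le> h 1 - h 0"
    by (intro tendsto_upperbound)
  then show ?thesis by (simp add: h_def inner_diff_right)
qed

lemma gradient_minimizer:
  fixes f :: "'a::euclidean_space \<Rightarrow> real"
  assumes "f differentiable (at x)" and "\<forall>y. f x \<le> f y"
  shows "gradient f x = 0"
proof -
  have "(\<lambda>h. gradient f x \<bullet> h) = (\<lambda>v. 0)"
    using has_derivative_local_min[OF gradient_has_derivative[OF assms(1)]] assms(2)
    by simp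
  then show ?thesis by (metis inner_eq_zero_iff)
qed

text \<open>The gradient vanishes at the minimizer \<open>a\<close>, so the Lipschitz bound makes
  the slope of \<open>f\<close> at \<open>a + u *\<^sub>R d\<close> at most
  \<open>L * u * (norm d)\<^sup>2\<close>. Subtracting the quadratic with exactly this slope leaves
  a function \<open>h\<close> that is nonincreasing on [0,1].\<close>

lemma smooth_upper_bound_minimizer:
  fixes f :: "'a::euclidean_space \<Rightarrow> real"
  assumes diff: "\<And>x. f differentiable (at x)"
    and lip: "\<And>x y. norm (gradient f x - gradient f y) \<le> L * norm (x - y)"
    and min: "\<forall>y. f a \<le> f y"
  shows "f x - f a \<le> L / 2 * (norm (x - a))\<^sup>2"
proof -
  define d where "d = x - a"
  define h where "h = (\<lambda>u. f (a + u *\<^sub>R d) - L / 2 * u\<^sup>2 * (norm d)\<^sup>2)"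
  have "h 1 \<le> h 0"
  proof (rule DERIV_nonpos_imp_nonincreasing[of 0 1 h])
    fix u :: real assume u: "0 \<le> u" "u \<le> 1"
    have "gradient f (a + u *\<^sub>R d) \<bullet> d \<le> norm (gradient f (a + u *\<^sub>R d)) * norm d"
      by (rule norm_cauchy_schwarz)
    also have "\<dots> \<le> L * (u * norm d) * norm d"
      using lip[of "a + u *\<^sub>R d" a] u gradient_minimizer[OF diff min]
      by (intro mult_right_mono) auto
    finally have "gradient f (a + u *\<^sub>R d) \<bullet> d - L * u * (norm d)\<^sup>2 \<le> 0"
      by (simp add: power2_eq_square mult.assoc)
    moreover have "(h has_real_derivative gradient f (a + u *\<^sub>R d) \<bullet> d - L * u * (norm d)\<^sup>2) (at u)"
      unfolding h_def
      by (intro DERIV_diff line_has_real_derivative diff) (auto intro!: derivative_eq_intros)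
    ultimately show "\<exists>y. (h has_real_derivative y) (at u) \<and> y \<le> 0" by blast
  qed simp
  then show ?thesis by (simp add: h_def d_def)
qed

lemma has_real_derivative_half_norm_sq:
  fixes w :: "real \<Rightarrow> 'a::real_inner"
  assumes "(w has_vector_derivative w') (at t within S)"
  shows "((\<lambda>u. (norm (w u))\<^sup>2 / 2) has_real_derivative w' \<bullet> w t) (at t within S)"
proof -
  have "((\<lambda>u. w u \<bullet> w u) has_real_derivative 2 * (w' \<bullet> w t)) (at t within S)"
    using bounded_bilinear.has_vector_derivative[OF bounded_bilinear_inner assms assms]
    by (simp add: has_real_derivative_iff_has_vector_derivative inner_commute)
  from DERIV_cdivide[OF this, of 2] show ?thesis
    by (simp add: power2_norm_eq_inner)
qed

text \<open>By the chain rule the Hessian term of the ODE is the time derivative of the gradient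
  along \<open>X\<close>. The summand \<open>2 *\<^sub>R (X u - c)\<close> completes
  \<open>V t\<close> to \<open>3 *\<^sub>R V t\<close>, so the ODE multiplied by \<open>t\<close>
  absorbs everything except gradient terms, with total coefficient - (t + 3/2 sqrt s) + sqrt s = -
  (t + sqrt s / 2). The constant \<open>c\<close> is arbitrary.\<close>

lemma nag_c_momentum_derivative:
  fixes f :: "real ^ 'n \<Rightarrow> real"
  assumes diff2: "gradient f differentiable (at (X t))"
    and X: "(X has_vector_derivative V t) (at t within S)"
    and V: "(V has_vector_derivative A) (at t within S)"
    and ode: "A + (3 / t) *\<^sub>R V t + sqrt s *\<^sub>R (hessian f (X t) *v V t)
      + (1 + 3 * sqrt s / (2 * t)) *\<^sub>R gradient f (X t) = 0"
    and "t \<noteq> 0"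
  shows "((\<lambda>u. u *\<^sub>R V u + 2 *\<^sub>R (X u - c) + (u * sqrt s) *\<^sub>R gradient f (X u))
    has_vector_derivative - ((t + sqrt s / 2) *\<^sub>R gradient f (X t))) (at t within S)"
proof -
  have g: "((\<lambda>u. gradient f (X u)) has_vector_derivative hessian f (X t) *v V t) (at t within S)"
    using vector_derivative_diff_chain_within[OF X has_derivative_at_withinI,
        OF hessian_has_derivative, OF diff2]
    by (simp add: comp_def)
  have "((\<lambda>u. u *\<^sub>R V u + 2 *\<^sub>R (X u - c) + (u * sqrt s) *\<^sub>R gradient f (X u))
    has_vector_derivative (t *\<^sub>R A + V t) + 2 *\<^sub>R V t
      + ((t * sqrt s) *\<^sub>R (hessian f (X t) *v V t) + sqrt s *\<^sub>R gradient f (X t))) (at t within S)"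
    by (rule derivative_eq_intros X V g refl | simp)+
  moreover have "(t *\<^sub>R A + V t) + 2 *\<^sub>R V t
      + ((t * sqrt s) *\<^sub>R (hessian f (X t) *v V t) + sqrt s *\<^sub>R gradient f (X t))
      = - ((t + sqrt s / 2) *\<^sub>R gradient f (X t))"
  proof -
    have "A = - ((3 / t) *\<^sub>R V t + sqrt s *\<^sub>R (hessian f (X t) *v V t)
      + (1 + 3 * sqrt s / (2 * t)) *\<^sub>R gradient f (X t))"
      using ode by (simp only: eq_neg_iff_add_eq_0 add.assoc)
    then show ?thesis
      using \<open>t \<noteq> 0\<close> by (subst \<open>A = _\<close>) (simp add: vec_eq_iff field_simps)
  qed
  ultimately show ?thesis by simp
qed

theorem theorem5:
  fixes f :: "real ^ 'n \<Rightarrow> real" and xstar x\<^sub>0 :: "real ^ 'n"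
    and X :: "real \<Rightarrow> real ^ 'n" and L s t\<^sub>0 t :: real
  assumes "L > 0"
    and "f \<in> F2 L"
    and "\<forall>y. f xstar \<le> f y"
    and "s > 0"
    and "t\<^sub>0 = 3 / 2 * sqrt s"
    and "nag_c_solution f s x\<^sub>0 t\<^sub>0 X"
    and "t > t\<^sub>0"
  shows "(INF u\<in>{t\<^sub>0..t}. (norm (gradient f (X u)))\<^sup>2)
    \<le> (12 + 9 * s * L) * (norm (x\<^sub>0 - xstar))\<^sup>2 / (2 * sqrt s * (t ^ 3 - t\<^sub>0 ^ 3))"
proof -
  have convex: "convex_on UNIV f"
    and diff: "\<And>x. f differentiable (at x)"
    and lip: "\<And>x y. norm (gradient f x - gradient f y) \<le> L * norm (x - y)"
    and diff2: "\<And>x. gradient f differentiable (at x)"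
    using assms(2) by (auto simp: F2_def)
  obtain V A where X: "\<And>u. u \<ge> t\<^sub>0 \<Longrightarrow> (X has_vector_derivative V u) (at u within {t\<^sub>0..})"
    and V: "\<And>u. u \<ge> t\<^sub>0 \<Longrightarrow> (V has_vector_derivative A u) (at u within {t\<^sub>0..})"
    and ode: "\<And>u. u \<ge> t\<^sub>0 \<Longrightarrow> A u + (3 / u) *\<^sub>R V u + sqrt s *\<^sub>R (hessian f (X u) *v V u)
                 + (1 + 3 * sqrt s / (2 * u)) *\<^sub>R gradient f (X u) = 0"
    and init: "X t\<^sub>0 = x\<^sub>0" "V t\<^sub>0 = - (sqrt s *\<^sub>R gradient f x\<^sub>0)"
    using assms(6) unfolding nag_c_solution_def by blast
  define r where "r = sqrt s"
  have r: "r > 0" "r\<^sup>2 = s" and t\<^sub>0: "t\<^sub>0 = 3 / 2 * r" "t\<^sub>0 > 0"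
    unfolding assms(5) r_def using assms(4) by simp_all
  define g where "g = (\<lambda>u. gradient f (X u))"
  define w where "w = (\<lambda>u. u *\<^sub>R V u + 2 *\<^sub>R (X u - xstar) + (u * r) *\<^sub>R g u)"
  \<comment> \<open>The interval is fixed here, so \<open>m\<close> is constant in \<open>u\<close>
    and the decay rate \<open>r * m * u\<^sup>2\<close> has the explicit primitive
    \<open>r * m * u ^ 3 / 3\<close>.\<close>
  define m where "m = (INF u\<in>{t\<^sub>0..t}. (norm (g u))\<^sup>2)"
  \<comment> \<open>The weight \<open>u * (u + r / 2)\<close> makes the term in
    \<open>g u \<bullet> V u\<close> from differentiating \<open>f (X u)\<close> cancel the one from
    the derivative of the squared norm of \<open>w\<close>; \<open>E'\<close> is what
    remains.\<close>
  define E where "E = (\<lambda>u. u * (u + r / 2) * (f (X u) - f xstar) + (norm (w u))\<^sup>2 / 2)"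
  define E' where "E' = (\<lambda>u. (2 * u + r / 2) * (f (X u) - f xstar)
    - (u + r / 2) * (2 * (g u \<bullet> (X u - xstar)) + u * r * (norm (g u))\<^sup>2))"
  have w_deriv: "(w has_vector_derivative - ((u + r / 2) *\<^sub>R g u)) (at u within {t\<^sub>0..})"
    if "u \<ge> t\<^sub>0" for u
    unfolding w_def g_def r_def
    by (rule nag_c_momentum_derivative[OF diff2 X V ode]) (use that t\<^sub>0(2) in auto)
  have f_deriv: "((\<lambda>u. f (X u)) has_real_derivative g u \<bullet> V u) (at u within {t\<^sub>0..})"
    if "u \<ge> t\<^sub>0" for u
    using vector_derivative_diff_chain_within[OF X[OF that] has_derivative_at_withinI,
        OF gradient_has_derivative, OF diff]
    by (simp add: has_real_derivative_iff_has_vector_derivative comp_def g_def)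
  have E_deriv: "(E has_real_derivative E' u) (at u within {t\<^sub>0..})" if "u \<ge> t\<^sub>0" for u
  proof -
    have "(E has_real_derivative
        (2 * u + r / 2) * (f (X u) - f xstar) + u * (u + r / 2) * (g u \<bullet> V u)
        + - ((u + r / 2) *\<^sub>R g u) \<bullet> w u) (at u within {t\<^sub>0..})"
      unfolding E_def
      by (intro DERIV_add has_real_derivative_half_norm_sq w_deriv that)
        (auto intro!: derivative_eq_intros f_deriv that simp: field_simps)
    moreover have "(2 * u + r / 2) * (f (X u) - f xstar) + u * (u + r / 2) * (g u \<bullet> V u)
        + - ((u + r / 2) *\<^sub>R g u) \<bullet> w u = E' u"
      by (simp add: E'_def w_def inner_add_right power2_norm_eq_inner algebra_simps)
    ultimately show ?thesis by simp
  qed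
  have E'_le: "E' u \<le> - (r * m * u\<^sup>2)" if u: "u \<in> {t\<^sub>0..t}" for u
  proof -
    have "u > 0" using u t\<^sub>0 by auto
    have "m \<le> (norm (g u))\<^sup>2"
      unfolding m_def using u by (intro cINF_lower bdd_belowI2[of _ 0]) auto
    then have "r * u\<^sup>2 * m \<le> r * u\<^sup>2 * (norm (g u))\<^sup>2"
      using r by (intro mult_left_mono) auto
    \<comment> \<open>After convexity is applied with factor \<open>2 * u + r\<close>, half of each
      of these two quantities is left in \<open>E'\<close> with a minus sign, and both are
      discarded.\<close>
    moreover have "0 \<le> r * (f (X u) - f xstar)" "0 \<le> u * r * (r * (norm (g u))\<^sup>2)"
      using assms(3) r \<open>u > 0\<close> by auto
    moreover have "(2 * u + r) * (f (X u) - f xstar) \<le> (2 * u + r) * (g u \<bullet> (X u - xstar))"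
      unfolding g_def using r \<open>u > 0\<close>
      by (intro mult_left_mono convex_gradient_ineq convex diff) auto
    ultimately show ?thesis
      by (simp add: E'_def algebra_simps power2_eq_square)
  qed
  \<comment> \<open>Integration is replaced by monotonicity of
    \<open>E u + r * m * u ^ 3 / 3\<close>. At \<open>t\<^sub>0\<close> only a one-sided derivative
    is available, so derivatives are taken on the open interval and continuity covers the
    endpoints.\<close>
  have "E t + r * m * t ^ 3 / 3 \<le> E t\<^sub>0 + r * m * t\<^sub>0 ^ 3 / 3"
  proof (rule DERIV_nonpos_imp_decreasing_open[of t\<^sub>0 t "\<lambda>u. E u + r * m * u ^ 3 / 3"])
    show "t\<^sub>0 \<le> t" using assms(7) by simp
    fix u assume u: "t\<^sub>0 < u" "u < t"
    then have "at u within {t\<^sub>0..} = at u"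
      by (intro at_within_interior) simp
    then have "(E has_real_derivative E' u) (at u)"
      using E_deriv[of u] u by simp
    then have "((\<lambda>u. E u + r * m * u ^ 3 / 3) has_real_derivative E' u + r * m * u\<^sup>2) (at u)"
      by (auto intro!: derivative_eq_intros)
    moreover have "E' u + r * m * u\<^sup>2 \<le> 0" using E'_le[of u] u by simp
    ultimately show "\<exists>y. ((\<lambda>u. E u + r * m * u ^ 3 / 3) has_real_derivative y) (at u) \<and> y \<le> 0"
      by blast
  next
    have "continuous_on {t\<^sub>0..} E"
      using E_deriv by (intro DERIV_continuous_on) auto
    then have "continuous_on {t\<^sub>0..t} E" by (rule continuous_on_subset) auto
    then show "continuous_on {t\<^sub>0..t} (\<lambda>u. E u + r * m * u ^ 3 / 3)"
      by (intro continuous_intros) auto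
  qed
  moreover have "E t \<ge> 0"
    unfolding E_def using r t\<^sub>0 assms(3,7) by (intro add_nonneg_nonneg mult_nonneg_nonneg) auto
  ultimately have "r * m * (t ^ 3 - t\<^sub>0 ^ 3) \<le> 3 * E t\<^sub>0"
    by (simp add: algebra_simps)
  also have "E t\<^sub>0 = 3 * s * (f x\<^sub>0 - f xstar) + 2 * (norm (x\<^sub>0 - xstar))\<^sup>2"
  proof -
    \<comment> \<open>The prescribed initial velocity cancels the gradient term of \<open>w\<close>,
      and the starting time 3/2 r turns the weight into 3/2 r * 2 r = 3 s.\<close>
    have "w t\<^sub>0 = 2 *\<^sub>R (x\<^sub>0 - xstar)" by (simp add: w_def init g_def r_def)
    moreover have "t\<^sub>0 * (t\<^sub>0 + r / 2) = 3 * s"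
      unfolding t\<^sub>0(1) r(2)[symmetric] by (simp add: power2_eq_square)
    ultimately show ?thesis by (simp add: E_def init power_mult_distrib)
  qed
  also have "\<dots> \<le> 3 * s * (L / 2 * (norm (x\<^sub>0 - xstar))\<^sup>2) + 2 * (norm (x\<^sub>0 - xstar))\<^sup>2"
    using assms(3,4) by (intro add_right_mono mult_left_mono smooth_upper_bound_minimizer diff lip) auto
  \<comment> \<open>Doubling the bound 3 (3 s L / 2 + 2) on the coefficient of the squared distance
    gives 12 + 9 s L.\<close>
  finally have "m * (2 * r * (t ^ 3 - t\<^sub>0 ^ 3)) \<le> (12 + 9 * s * L) * (norm (x\<^sub>0 - xstar))\<^sup>2"
    by (simp add: algebra_simps)
  moreover have "2 * r * (t ^ 3 - t\<^sub>0 ^ 3) > 0"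
    using r t\<^sub>0 assms(7) by (simp add: power_strict_mono)
  ultimately have "m \<le> (12 + 9 * s * L) * (norm (x\<^sub>0 - xstar))\<^sup>2 / (2 * r * (t ^ 3 - t\<^sub>0 ^ 3))"
    by (simp add: pos_le_divide_eq)
  then show ?thesis by (simp add: m_def g_def r_def)
qed

end
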